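(* Let $\delta,\kappa,\lambda>0$ and $\mu\ge 0$ be constants, $h(x)=\kappa x^2+\mu$ and $g(x)=\lambda x^2$. Suppose that $\delta\lambda-\kappa>0$ and $\sqrt{\frac{\kappa+\delta\mu}{\delta(\delta\lambda-\kappa)}}=\frac{\delta}{2\kappa}$. Then the function $$u(x)=\begin{cases}\dfrac{\kappa}{\delta}x^2+\dfrac{\kappa+\delta\mu}{\delta^2},&|x|\le\dfrac{\delta}{2\kappa},\\[6pt] |x|-\dfrac{\delta}{2\kappa}+\dfrac{\lambda\delta^2}{4\kappa^2},&|x|>\dfrac{\delta}{2\kappa},\end{cases}$$ is a $C^1$ function that is a candidate for the value function (as defined in the context).
   Context: Candidate for the value function (for the data $b\equiv0$, $\sigma\equiv1$, constant discount rate $\delta$, running payoff $h(x)=\kappa x^2+\mu$, terminal payoff $g(x)=\lambda x^2$). Let $\mathcal{L}u(x)=\frac12u''(x)-\delta u(x)$. A candidate is a continuous $u:\mathbb{R}\to\mathbb{R}_+$ that is $C^1$ with absolutely continuous first derivative inside $\mathbb{R}\setminus\mathcal{B}$, where $\mathcal{B}$ is a finite set, that satisfies $|u'(x)|\le 1$ for all $x\in\mathbb{R}\setminus\mathcal{B}$, and that has properties (i)–(iii) below, where $\mathcal{C}=\mathrm{cl}\big[\mathrm{int}\{x\in\mathbb{R}\setminus\mathcal{B}: |u'(x)|=1\}\big]$, $\mathcal{S}_{\mathcal W}=\{x: u(x)=g(x)\}$, $\mathcal{S}_{\mathcal C}=\mathrm{cl}\{x: u(x)<g(x)\}$, $\mathcal{S}=\mathcal{S}_{\mathcal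 W}\cup\mathcal{S}_{\mathcal C}$, $\mathcal{W}=\mathbb{R}\setminus(\mathcal{C}\cup\mathcal{S})$: (i) each of $\mathcal{C},\mathcal{S}_{\mathcal W},\mathcal{S}_{\mathcal C}$ is a finite union of intervals (single points allowed), and $\mathcal{B}\subseteq\mathcal{S}_{\mathcal C}\subseteq\mathcal{C}$; (ii) $\mathcal{L}u+h=0$ Lebesgue-a.e. in $\mathcal{W}$; $\mathcal{L}u+h\ge0$ a.e. in $\mathrm{int}(\mathcal{C}\setminus\mathcal{S})$; $\mathcal{L}u+h=\mathcal{L}g+h\le0$ a.e. in $\mathrm{int}\,\mathcal{S}_{\mathcal W}$ (no sign condition in $\mathrm{int}\,\mathcal{S}_{\mathcal C}\setminus\mathcal{B}$); (iii) for every $c\in\mathcal{B}$, with $u'_\mp(c)$ the left/right derivatives, either $u'_-(c)=1$ and $u'_+(c)<1$, or $u'_-(c)>-1$ and $u'_+(c)=-1$. *)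

theory Defs
  imports "HOL-Analysis.Analysis"
begin

(* The library constant absolutely_continuous is about measures; this is the epsilon-delta
   notion for functions. F is a finite family of non-overlapping intervals [s,t], encoded by
   endpoints; degenerate pairs (t,t) contribute nothing to either sum. *)
definition abs_cont_fun_on :: "real set \<Rightarrow> (real \<Rightarrow> real) \<Rightarrow> bool" where
  "abs_cont_fun_on S f \<longleftrightarrow>
     (\<forall>\<epsilon>>0. \<exists>\<eta>>0. \<forall>F :: (real \<times> real) set.
        finite F \<longrightarrow>
        (\<forall>(s, t)\<in>F. s \<le> t \<and> {s..t} \<subseteq> S) \<longrightarrow>
        disjoint_family_on (\<lambda>(s, t). {s<..<t}) F \<longrightarrow>
        (\<Sum>(s, t)\<in>F. t - s) < \<eta> \<longrightarrow>
        (\<Sum>(s, t)\<in>F. \<bar>f t - f s\<bar>) < \<epsilon>)"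

(* On an open set, absolute continuity is meant on each compact subinterval. *)
definition loc_abs_cont_fun_on :: "real set \<Rightarrow> (real \<Rightarrow> real) \<Rightarrow> bool" where
  "loc_abs_cont_fun_on S f \<longleftrightarrow> (\<forall>a b. {a..b} \<subseteq> S \<longrightarrow> abs_cont_fun_on {a..b} f)"

(* The interval [a,a] is the single point a; empty and unbounded intervals are included. *)
definition finite_union_of_intervals :: "real set \<Rightarrow> bool" where
  "finite_union_of_intervals A \<longleftrightarrow> (\<exists>F. finite F \<and> (\<forall>I\<in>F. is_interval I) \<and> A = \<Union>F)"

(* Drift b = 0, volatility 1, discount rate delta. *)
definition gen_L :: "real \<Rightarrow> (real \<Rightarrow> real) \<Rightarrow> real \<Rightarrow> real" where
  "gen_L \<delta> u x = 1/2 * deriv (deriv u) x - \<delta> * u x"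

definition control_set :: "real set \<Rightarrow> (real \<Rightarrow> real) \<Rightarrow> real set" where
  "control_set B u = closure (interior {x. x \<notin> B \<and> \<bar>deriv u x\<bar> = 1})"

definition stop_wait_set :: "(real \<Rightarrow> real) \<Rightarrow> (real \<Rightarrow> real) \<Rightarrow> real set" where
  "stop_wait_set g u = {x. u x = g x}"

definition stop_control_set :: "(real \<Rightarrow> real) \<Rightarrow> (real \<Rightarrow> real) \<Rightarrow> real set" where
  "stop_control_set g u = closure {x. u x < g x}"

definition stop_set :: "(real \<Rightarrow> real) \<Rightarrow> (real \<Rightarrow> real) \<Rightarrow> real set" where
  "stop_set g u = stop_wait_set g u \<union> stop_control_set g u"

definition wait_set :: "real set \<Rightarrow> (real \<Rightarrow> real) \<Rightarrow> (real \<Rightarrow> real) \<Rightarrow> real set" where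
  "wait_set B g u = - (control_set B u \<union> stop_set g u)"

(* As B is contained in S_C = stop_control_set, it misses the wait set and C - S; it also misses
   int S_W, since int S_W is an open set disjoint from {u < g}, hence from its closure S_C. Local
   absolute continuity of u' off B therefore makes deriv (deriv u) the genuine second derivative
   at almost every point where gen_L is used. *)
definition candidate_with ::
    "real set \<Rightarrow> real \<Rightarrow> (real \<Rightarrow> real) \<Rightarrow> (real \<Rightarrow> real) \<Rightarrow> (real \<Rightarrow> real) \<Rightarrow> bool" where
  "candidate_with B \<delta> h g u \<longleftrightarrow>
     finite B \<and>
     (\<forall>x. 0 \<le> u x) \<and> continuous_on UNIV u \<and>
     u C1_differentiable_on (- B) \<and> loc_abs_cont_fun_on (- B) (deriv u) \<and>
     (\<forall>x. x \<notin> B \<longrightarrow> \<bar>deriv u x\<bar> \<le> 1) \<and>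
     finite_union_of_intervals (control_set B u) \<and>
     finite_union_of_intervals (stop_wait_set g u) \<and>
     finite_union_of_intervals (stop_control_set g u) \<and>
     B \<subseteq> stop_control_set g u \<and> stop_control_set g u \<subseteq> control_set B u \<and>
     (AE x in lebesgue. x \<in> wait_set B g u \<longrightarrow> gen_L \<delta> u x + h x = 0) \<and>
     (AE x in lebesgue. x \<in> interior (control_set B u - stop_set g u) \<longrightarrow>
        gen_L \<delta> u x + h x \<ge> 0) \<and>
     (AE x in lebesgue. x \<in> interior (stop_wait_set g u) \<longrightarrow>
        gen_L \<delta> u x + h x = gen_L \<delta> g x + h x \<and> gen_L \<delta> g x + h x \<le> 0) \<and>
     (\<forall>c\<in>B. \<exists>l r. (u has_real_derivative l) (at_left c) \<and>
                   (u has_real_derivative r) (at_right c) \<and>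
                   (l = 1 \<and> r < 1 \<or> l > -1 \<and> r = -1))"

definition candidate ::
    "real \<Rightarrow> (real \<Rightarrow> real) \<Rightarrow> (real \<Rightarrow> real) \<Rightarrow> (real \<Rightarrow> real) \<Rightarrow> bool" where
  "candidate \<delta> h g u \<longleftrightarrow> (\<exists>B. candidate_with B \<delta> h g u)"

end

theory Submission
  imports Defs
begin

text \<open>
  Write \<open>c = \<kappa>/\<delta>\<close> and \<open>a = 1/(2c) = \<delta>/(2\<kappa>)\<close>. The square-root hypothesis says exactly that
  \<open>(\<kappa> + \<delta>\<mu>)/\<delta>\<^sup>2 = (lam - c) a\<^sup>2\<close>. This is the matching condition \<open>u(a) = g(a)\<close>, while the slope of the
  parabola at \<open>a\<close> is \<open>2ca = 1\<close>. Hence \<open>u\<close> is a Huber function: a parabola continued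
  along its tangent lines at \<open>\<plusminus>a\<close>. It can be written in one formula,
  \<open>u(x) = c x\<^sup>2 + (lam - c) a\<^sup>2 - c (x - a)\<^sub>+\<^sup>2 - c (-x - a)\<^sub>+\<^sup>2\<close>,
  so it is continuously differentiable, and its derivative is \<open>2cx\<close> clamped to \<open>[-1, 1]\<close>
  (\<open>huber_has_real_derivative\<close>). This derivative is Lipschitz, hence absolutely continuous
  (\<open>lipschitz_on_imp_abs_cont_fun_on\<close>). The exceptional set can therefore be taken empty.

  Since \<open>u - g = (lam - c)(a\<^sup>2 - x\<^sup>2)\<close> inside \<open>[-a, a]\<close>, and outside
  \<open>g - u = (\<bar>x\<bar> - a)(lam (\<bar>x\<bar> + a) - 1) > 0\<close> because \<open>2 a lam = lam/c > 1\<close>, the waiting set is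
  \<open>(-a, a)\<close>, the stop-from-waiting set is \<open>{-a, a}\<close>, and the control and stop-control sets both equal
  \<open>{x. a \<le> \<bar>x\<bar>}\<close>. Two of the three differential conditions concern sets with empty interior; the
  remaining one is the identity \<open>c - \<delta>(c x\<^sup>2 + (\<kappa> + \<delta>\<mu>)/\<delta>\<^sup>2) + \<kappa> x\<^sup>2 + \<mu> = 0\<close>.
\<close>

section \<open>Absolute continuity of Lipschitz functions\<close>

lemma lipschitz_on_imp_abs_cont_fun_on:
  assumes "L-lipschitz_on S f"
  shows "abs_cont_fun_on S f"
  unfolding abs_cont_fun_on_def
proof (intro allI impI)
  fix \<epsilon> :: real assume "\<epsilon> > 0"
  have L: "L \<ge> 0" using assms lipschitz_on_nonneg by blast
  \<comment> \<open>\<open>L + 1\<close> instead of \<open>L\<close> keeps the quotient meaningful when \<open>L = 0\<close>.\<close>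
  show "\<exists>\<eta>>0. \<forall>F. finite F \<longrightarrow> (\<forall>(s, t)\<in>F. s \<le> t \<and> {s..t} \<subseteq> S) \<longrightarrow>
          disjoint_family_on (\<lambda>(s, t). {s<..<t}) F \<longrightarrow>
          (\<Sum>(s, t)\<in>F. t - s) < \<eta> \<longrightarrow> (\<Sum>(s, t)\<in>F. \<bar>f t - f s\<bar>) < \<epsilon>"
  proof (intro exI[of _ "\<epsilon> / (L + 1)"] conjI allI impI)
    show "0 < \<epsilon> / (L + 1)" using \<open>\<epsilon> > 0\<close> L by simp
  next
    fix F :: "(real \<times> real) set"
    assume F: "\<forall>(s, t)\<in>F. s \<le> t \<and> {s..t} \<subseteq> S"
      and small: "(\<Sum>(s, t)\<in>F. t - s) < \<epsilon> / (L + 1)"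
    have "(\<Sum>(s, t)\<in>F. \<bar>f t - f s\<bar>) \<le> (\<Sum>(s, t)\<in>F. (L + 1) * (t - s))"
    proof (rule sum_mono, clarify)
      fix s t assume "(s, t) \<in> F"
      then have st: "s \<le> t" "s \<in> S" "t \<in> S" using F by fastforce+
      have "\<bar>f t - f s\<bar> \<le> L * (t - s)"
        using lipschitz_onD[OF assms st(3,2)] st(1) by (simp add: dist_real_def)
      also have "\<dots> \<le> (L + 1) * (t - s)" using st(1) by (simp add: mult_right_mono)
      finally show "\<bar>f t - f s\<bar> \<le> (L + 1) * (t - s)" .
    qed
    also have "\<dots> = (L + 1) * (\<Sum>(s, t)\<in>F. t - s)"
      by (simp add: sum_distrib_left case_prod_unfold)
    also have "\<dots> < \<epsilon>" using small L by (simp add: pos_less_divide_eq mult.commute)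
    finally show "(\<Sum>(s, t)\<in>F. \<bar>f t - f s\<bar>) < \<epsilon>" .
  qed
qed

section \<open>The complement of a symmetric interval\<close>

lemma abs_ge_eq_Un: "{x::real. a \<le> \<bar>x\<bar>} = {a..} \<union> {..-a}"
  by auto

lemma interior_abs_ge:
  fixes a :: real assumes "a > 0"
  shows "interior {x. a \<le> \<bar>x\<bar>} = {x. a < \<bar>x\<bar>}"
proof -
  have "{x. a \<le> \<bar>x\<bar>} = - {-a<..<a}" by auto
  moreover have "{x. a < \<bar>x\<bar>} = - {-a..a}" by auto
  ultimately show ?thesis using assms by (simp add: interior_complement)
qed

lemma closure_abs_gt: "closure {x::real. a < \<bar>x\<bar>} = {x. a \<le> \<bar>x\<bar>}"
proof -
  have "{x. a < \<bar>x\<bar>} = {a<..} \<union> {..<-a}" by auto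
  then show ?thesis by (simp add: abs_ge_eq_Un closure_greaterThan closure_lessThan)
qed

lemma finite_union_of_intervals_abs_ge: "finite_union_of_intervals {x::real. a \<le> \<bar>x\<bar>}"
  unfolding finite_union_of_intervals_def
  by (rule exI[of _ "{{a..}, {..-a}}"]) (auto simp: abs_ge_eq_Un is_interval_ci is_interval_ic)

section \<open>Huber functions\<close>

text \<open>
  The squared positive part measures how far a parabola exceeds its tangent line beyond the point
  of contact, so this derivative gives the smooth gluing at \<open>\<plusminus>a\<close>. The remainder of the
  linearization lies between \<open>0\<close> and \<open>(y - x)\<^sup>2\<close>, also across the kink.
\<close>

lemma has_real_derivative_pos_part_squared:
  "((\<lambda>x::real. (max 0 x)\<^sup>2) has_real_derivative 2 * max 0 x) (at x)"
proof -
  have bound: "\<bar>((max 0 y)\<^sup>2 - (max 0 x)\<^sup>2) / (y - x) - 2 * max 0 x\<bar> \<le> \<bar>y - x\<bar>"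
    if "y \<noteq> x" for y
  proof -
    let ?r = "(max 0 y)\<^sup>2 - (max 0 x)\<^sup>2 - 2 * max 0 x * (y - x)"
    have "\<bar>?r\<bar> \<le> (y - x)\<^sup>2"
    proof (cases "0 \<le> x"; cases "0 \<le> y")
      assume "0 \<le> x" "0 \<le> y"
      then have "?r = (y - x)\<^sup>2" by (simp add: power2_eq_square algebra_simps)
      then show ?thesis by simp
    next
      assume "0 \<le> x" "\<not> 0 \<le> y"
      moreover from this have "x * y \<le> 0" by (simp add: mult_nonneg_nonpos)
      moreover have "?r = x\<^sup>2 - 2 * (x * y)"
        using \<open>0 \<le> x\<close> \<open>\<not> 0 \<le> y\<close> by (simp add: power2_eq_square algebra_simps)
      moreover have "(y - x)\<^sup>2 = x\<^sup>2 - 2 * (x * y) + y\<^sup>2"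
        by (simp add: power2_eq_square algebra_simps)
      moreover have "0 \<le> x\<^sup>2 - 2 * (x * y)"
        using \<open>x * y \<le> 0\<close> zero_le_power2[of x] by linarith
      ultimately show ?thesis by simp
    next
      assume "\<not> 0 \<le> x" "0 \<le> y"
      then have "x * y \<le> 0" by (simp add: mult_nonpos_nonneg)
      with \<open>\<not> 0 \<le> x\<close> \<open>0 \<le> y\<close> show ?thesis
        by (simp add: max_def power2_eq_square algebra_simps)
    qed (simp add: max_def)
    moreover have "((max 0 y)\<^sup>2 - (max 0 x)\<^sup>2) / (y - x) - 2 * max 0 x = ?r / (y - x)"
      using that by (simp add: field_simps)
    ultimately show ?thesis
      using that by (simp add: abs_divide divide_le_eq power2_eq_square flip: abs_mult)
  qed
  show ?thesis
    unfolding has_field_derivative_iff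
  proof (rule LIM_zero_cancel, rule Lim_null_comparison)
    show "\<forall>\<^sub>F y in at x. norm (((max 0 y)\<^sup>2 - (max 0 x)\<^sup>2) / (y - x) - 2 * max 0 x) \<le> \<bar>y - x\<bar>"
      using bound by (auto simp: eventually_at_filter)
    have "((\<lambda>y. \<bar>y - x\<bar>) \<longlongrightarrow> \<bar>x - x\<bar>) (at x)" by (intro tendsto_intros)
    then show "((\<lambda>y. \<bar>y - x\<bar>) \<longlongrightarrow> 0) (at x)" by simp
  qed
qed

definition unit_clamp :: "real \<Rightarrow> real" where
  "unit_clamp y = max (-1) (min 1 y)"

lemma lipschitz_on_unit_clamp:
  assumes "c \<ge> 0"
  shows "(2 * c)-lipschitz_on S (\<lambda>x. unit_clamp (2 * c * x))"
proof (rule lipschitz_onI)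
  fix x y :: real
  have "\<bar>unit_clamp (2 * c * x) - unit_clamp (2 * c * y)\<bar> \<le> \<bar>2 * c * x - 2 * c * y\<bar>"
    by (auto simp: unit_clamp_def max_def min_def)
  also have "\<dots> = 2 * c * \<bar>x - y\<bar>"
    using assms by (simp add: abs_mult flip: right_diff_distrib)
  finally show "dist (unit_clamp (2 * c * x)) (unit_clamp (2 * c * y)) \<le> 2 * c * dist x y"
    by (simp add: dist_real_def)
qed (use assms in simp)

text \<open>
  The condition \<open>2 c a = 1\<close> makes the parabola have slope \<open>1\<close> at \<open>a\<close>; subtracting \<open>c (x - a)\<^sup>2\<close>
  beyond \<open>a\<close> cancels the curvature and leaves the tangent line.
\<close>

lemma huber_has_real_derivative:
  fixes a c d :: real and u :: "real \<Rightarrow> real"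
  assumes "c > 0" and ca: "2 * c * a = 1"
    and u: "\<And>x. u x = (if \<bar>x\<bar> \<le> a then c * x\<^sup>2 + d else \<bar>x\<bar> - a + (c * a\<^sup>2 + d))"
  shows "(u has_real_derivative unit_clamp (2 * c * x)) (at x)"
proof -
  let ?v = "\<lambda>x. c * x\<^sup>2 + d - c * (max 0 (x - a))\<^sup>2 - c * (max 0 (-x - a))\<^sup>2"
  have "a > 0" using assms(1) ca by (metis mult_pos_pos zero_less_mult_pos zero_less_numeral zero_less_one)
  have tangent: "c * y\<^sup>2 - c * (y - a)\<^sup>2 = y - a + c * a\<^sup>2" for y
  proof -
    have "c * y\<^sup>2 - c * (y - a)\<^sup>2 = (2 * c * a) * (y - a) + c * a\<^sup>2"
      by (simp add: power2_eq_square algebra_simps)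
    then show ?thesis by (simp add: ca)
  qed
  have "u = ?v"
  proof
    fix x
    consider "\<bar>x\<bar> \<le> a" | "x > a" | "x < -a" by linarith
    then show "u x = ?v x"
    proof cases
      case 1 then show ?thesis by (simp add: u max_absorb1 abs_le_iff)
    next
      case 2 then show ?thesis using \<open>a > 0\<close> tangent[of x] by (simp add: u max_def)
    next
      case 3 then show ?thesis using \<open>a > 0\<close> tangent[of "-x"] by (simp add: u max_def)
    qed
  qed
  have pos: "((\<lambda>x. (max 0 (x - a))\<^sup>2) has_real_derivative 2 * max 0 (x - a) * 1) (at x)"
    by (rule DERIV_chain2[OF has_real_derivative_pos_part_squared])
      (auto intro!: derivative_eq_intros)
  have neg: "((\<lambda>x. (max 0 (-x - a))\<^sup>2) has_real_derivative 2 * max 0 (-x - a) * (-1)) (at x)"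
    by (rule DERIV_chain2[OF has_real_derivative_pos_part_squared])
      (auto intro!: derivative_eq_intros)
  have "(?v has_real_derivative
          2 * c * x - c * (2 * max 0 (x - a) * 1) - c * (2 * max 0 (-x - a) * (-1))) (at x)"
    by (rule derivative_eq_intros pos neg refl | simp)+
  moreover have "2 * c * x - c * (2 * max 0 (x - a) * 1) - c * (2 * max 0 (-x - a) * (-1))
                   = unit_clamp (2 * c * x)"
  proof -
    have scale: "y \<le> z \<longleftrightarrow> 2 * c * y \<le> 2 * c * z" for y z using \<open>c > 0\<close> by simp
    consider "\<bar>x\<bar> \<le> a" | "x > a" | "x < -a" by linarith
    then show ?thesis
    proof cases
      case 1
      then have "2 * c * x \<le> 1" "-1 \<le> 2 * c * x"
        using scale[of x a] scale[of "-a" x] ca by auto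
      with 1 show ?thesis by (simp add: unit_clamp_def max_def abs_le_iff)
    next
      case 2
      then have "1 \<le> 2 * c * x" using scale[of a x] ca by auto
      with 2 \<open>a > 0\<close> ca show ?thesis by (simp add: unit_clamp_def max_def algebra_simps)
    next
      case 3
      then have "2 * c * x \<le> -1" using scale[of x "-a"] ca by auto
      with 3 \<open>a > 0\<close> ca show ?thesis by (simp add: unit_clamp_def max_def min_def algebra_simps)
    qed
  qed
  ultimately show ?thesis unfolding \<open>u = ?v\<close> by simp
qed

section \<open>The candidate\<close>

theorem proposition5:
  fixes \<delta> \<kappa> lam \<mu> :: real and h g u :: "real \<Rightarrow> real"
  assumes "\<delta> > 0" and "\<kappa> > 0" and "lam > 0" and "\<mu> \<ge> 0"
    and "\<And>x. h x = \<kappa> * x\<^sup>2 + \<mu>"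
    and "\<And>x. g x = lam * x\<^sup>2"
    and "\<delta> * lam - \<kappa> > 0"
    and "sqrt ((\<kappa> + \<delta> * \<mu>) / (\<delta> * (\<delta> * lam - \<kappa>))) = \<delta> / (2 * \<kappa>)"
    and "\<And>x. u x = (if \<bar>x\<bar> \<le> \<delta> / (2 * \<kappa>)
                     then \<kappa> / \<delta> * x\<^sup>2 + (\<kappa> + \<delta> * \<mu>) / \<delta>\<^sup>2
                     else \<bar>x\<bar> - \<delta> / (2 * \<kappa>) + lam * \<delta>\<^sup>2 / (4 * \<kappa>\<^sup>2))"
  shows "u C1_differentiable_on UNIV \<and> candidate \<delta> h g u"
proof -
  define a where "a = \<delta> / (2 * \<kappa>)"
  define c where "c = \<kappa> / \<delta>"
  define d where "d = (\<kappa> + \<delta> * \<mu>) / \<delta>\<^sup>2"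
  note h = assms(5) and g = assms(6)
  have "a > 0" "c > 0" and ca: "2 * c * a = 1" and "lam > c"
    using assms(1,2,7) by (auto simp: a_def c_def field_simps)
  have "d > 0" using assms(1,2,4) by (simp add: d_def add_pos_nonneg)
  have "a\<^sup>2 = (\<kappa> + \<delta> * \<mu>) / (\<delta> * (\<delta> * lam - \<kappa>))"
  proof -
    have "0 \<le> (\<kappa> + \<delta> * \<mu>) / (\<delta> * (\<delta> * lam - \<kappa>))" using assms(1,2,4,7) by simp
    then show ?thesis unfolding a_def assms(8)[symmetric] by (rule real_sqrt_pow2)
  qed
  then have match: "d = (lam - c) * a\<^sup>2"
    using assms(1,7) by (simp add: d_def c_def field_simps power2_eq_square)
  have u: "u x = (if \<bar>x\<bar> \<le> a then c * x\<^sup>2 + d else \<bar>x\<bar> - a + (c * a\<^sup>2 + d))" for x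
  proof -
    have "lam * \<delta>\<^sup>2 / (4 * \<kappa>\<^sup>2) = lam * a\<^sup>2" by (simp add: a_def power_divide power_mult_distrib)
    also have "\<dots> = c * a\<^sup>2 + d" by (simp add: match algebra_simps)
    finally show ?thesis by (simp add: assms(9) a_def c_def d_def)
  qed
  have der: "(u has_real_derivative unit_clamp (2 * c * x)) (at x)" for x
    using huber_has_real_derivative[OF \<open>c > 0\<close> ca u] .
  then have deriv_u: "deriv u = (\<lambda>x. unit_clamp (2 * c * x))"
    by (auto intro: DERIV_imp_deriv)
  have lip: "(2 * c)-lipschitz_on S (deriv u)" for S
    unfolding deriv_u using \<open>c > 0\<close> by (intro lipschitz_on_unit_clamp) simp

  have C1: "u C1_differentiable_on UNIV"
    unfolding C1_differentiable_on_def
    using der lipschitz_on_continuous_on[OF lip[of UNIV]]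
    by (intro exI[of _ "deriv u"])
      (auto simp: deriv_u has_real_derivative_iff_has_vector_derivative)
  have cont: "continuous_on UNIV u"
    using der by (meson DERIV_isCont continuous_at_imp_continuous_on)

  have above: "u x > g x" if "\<bar>x\<bar> < a" for x
  proof -
    have "x\<^sup>2 < a\<^sup>2" using that \<open>a > 0\<close> by (simp add: power2_strict_mono)
    then have "0 < (lam - c) * (a\<^sup>2 - x\<^sup>2)" using \<open>lam > c\<close> by simp
    also have "\<dots> = u x - g x" using that by (simp add: u g match algebra_simps)
    finally show ?thesis by simp
  qed
  have touch: "u x = g x" if "\<bar>x\<bar> = a" for x
  proof -
    have "x\<^sup>2 = a\<^sup>2" using that by auto
    then show ?thesis using that by (simp add: u g match algebra_simps)
  qed
  have below: "u x < g x" if "\<bar>x\<bar> > a" for x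
  proof -
    have "2 * c * a < 2 * lam * a" using \<open>lam > c\<close> \<open>a > 0\<close> by simp
    also have "2 * lam * a = lam * (2 * a)" by simp
    also have "\<dots> \<le> lam * (\<bar>x\<bar> + a)" using that assms(3) by (intro mult_left_mono) auto
    finally have "0 < (\<bar>x\<bar> - a) * (lam * (\<bar>x\<bar> + a) - 1)" using that ca by simp
    also have "\<dots> = lam * \<bar>x\<bar>\<^sup>2 - (\<bar>x\<bar> - a + lam * a\<^sup>2)"
      by (simp add: power2_eq_square algebra_simps)
    also have "\<dots> = g x - u x" using that by (simp add: u g match algebra_simps)
    finally show ?thesis by simp
  qed

  have SW: "stop_wait_set g u = {-a, a}"
    unfolding stop_wait_set_def
  proof (intro set_eqI iffI)
    fix x assume "x \<in> {x. u x = g x}"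
    then have "\<bar>x\<bar> = a" using above[of x] below[of x] by (cases "\<bar>x\<bar>" a rule: linorder_cases) auto
    then show "x \<in> {-a, a}" by auto
  next
    fix x assume "x \<in> {-a, a}"
    then show "x \<in> {x. u x = g x}" using touch[of x] \<open>a > 0\<close> by auto
  qed
  have "{x. u x < g x} = {x. a < \<bar>x\<bar>}"
  proof (intro set_eqI iffI)
    fix x assume "x \<in> {x. u x < g x}"
    then show "x \<in> {x. a < \<bar>x\<bar>}"
      using above[of x] touch[of x] by (cases "\<bar>x\<bar>" a rule: linorder_cases) auto
  qed (use below in auto)
  then have SC: "stop_control_set g u = {x. a \<le> \<bar>x\<bar>}"
    by (simp add: stop_control_set_def closure_abs_gt)
  have "\<bar>deriv u x\<bar> = 1 \<longleftrightarrow> a \<le> \<bar>x\<bar>" for x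
  proof -
    have "a \<le> \<bar>x\<bar> \<longleftrightarrow> 1 \<le> \<bar>2 * c * x\<bar>"
      using \<open>c > 0\<close> mult_le_cancel_left_pos[of "2 * c" a "\<bar>x\<bar>"] ca by (simp add: abs_mult)
    then show ?thesis by (auto simp: deriv_u unit_clamp_def max_def min_def abs_if)
  qed
  then have C: "control_set {} u = {x. a \<le> \<bar>x\<bar>}"
    using \<open>a > 0\<close> by (simp add: control_set_def interior_abs_ge closure_abs_gt)

  have wait: "gen_L \<delta> u x + h x = 0" if "x \<in> wait_set {} g u" for x
  proof -
    have "\<bar>x\<bar> < a" using that by (auto simp: wait_set_def stop_set_def C SC)
    have "deriv u y = 2 * c * y" if "y \<in> {-a<..<a}" for y
    proof -
      have "\<bar>2 * c * y\<bar> < 1"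
        using that \<open>c > 0\<close> mult_strict_left_mono[of "\<bar>y\<bar>" a "2 * c"] ca
        by (auto simp: abs_mult)
      then show ?thesis by (auto simp: deriv_u unit_clamp_def abs_less_iff)
    qed
    then have "\<forall>\<^sub>F y in nhds x. deriv u y = 2 * c * y"
      using \<open>\<bar>x\<bar> < a\<close> eventually_nhds_in_open[of "{-a<..<a}" x]
      by (auto simp: abs_less_iff elim!: eventually_mono)
    then have "deriv (deriv u) x = deriv (\<lambda>y. 2 * c * y) x" by (rule deriv_cong_ev) simp
    also have "\<dots> = 2 * c" by simp
    finally show ?thesis
      using \<open>\<bar>x\<bar> < a\<close> assms(1)
      by (simp add: gen_L_def u h c_def d_def field_simps power2_eq_square)
  qed
  have CS: "control_set {} u - stop_set g u = {}"
    by (auto simp: C stop_set_def SC)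
  have SW_int: "interior (stop_wait_set g u) = {}"
    unfolding SW by (simp add: empty_interior_finite)
  have SW_union: "finite_union_of_intervals (stop_wait_set g u)"
    unfolding finite_union_of_intervals_def SW
    by (rule exI[of _ "{{-a}, {a}}"]) (auto simp: is_interval_1)
  have "candidate_with {} \<delta> h g u"
    unfolding candidate_with_def
  proof (intro conjI)
    show "\<forall>x. 0 \<le> u x" using \<open>c > 0\<close> \<open>d > 0\<close> by (auto simp: u)
    show "loc_abs_cont_fun_on (- {}) (deriv u)"
      unfolding loc_abs_cont_fun_on_def using lip lipschitz_on_imp_abs_cont_fun_on by blast
    show "\<forall>x. x \<notin> {} \<longrightarrow> \<bar>deriv u x\<bar> \<le> 1"
      by (auto simp: deriv_u unit_clamp_def)
    show "finite_union_of_intervals (control_set {} u)"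
      unfolding C by (rule finite_union_of_intervals_abs_ge)
    show "finite_union_of_intervals (stop_control_set g u)"
      unfolding SC by (rule finite_union_of_intervals_abs_ge)
    show "AE x in lebesgue. x \<in> interior (control_set {} u - stop_set g u) \<longrightarrow>
            gen_L \<delta> u x + h x \<ge> 0"
      by (simp add: CS)
  qed (use C1 cont wait SW_union in \<open>auto simp: C SC SW_int\<close>)
  then show ?thesis using C1 unfolding candidate_def by blast
qed

end
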